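(* Let $\pi:F\rightarrow G$ and $\pi':F'\rightarrow G'$ be groupoid bundles and let $(\phi,\tau)$ be a Zakrzewski-Pierce morphism from $\pi$ to $\pi'$. Then there is a semigroup homomorphism $\frac{\tau}{\phi}:\mathcal{S}(\pi)\rightarrow\mathcal{S}(\pi')$ between the semigroups of slice-sections, given by \[\tfrac{\tau}{\phi}(a)=\tau\circ(((a\circ\phi)\times\mathrm{id})\circ\delta),\] where $\delta(g')=(g',g')$ and $\mathrm{id}(g')=g'$; that is, $\mathrm{dom}(\tfrac{\tau}{\phi}(a))=\phi^{-1}[\mathrm{dom}(a)]$ and $\tfrac{\tau}{\phi}(a)(g')=\tau((a\circ\phi)(g'),g')$ for $g'$ in this domain.
   Context: Groupoids: a groupoid $G$ is viewed as a set of arrows; $G^0$ is its set of units, $\mathsf{s}(g)=g^{-1}g$, $\mathsf{r}(g)=gg^{-1}$, and $gh$ is defined iff $\mathsf{s}(g)=\mathsf{r}(h)$. A slice is a subset on which $\mathsf{s}$ and $\mathsf{r}$ are both injective. A topological groupoid has continuous inverse and product; it is étale if $\mathsf{s}$ maps open subsets of $G$ to open subsets of $G$. No Hausdorff assumptions are made. A groupoid bundle is a map $\pi:F\to G$ where $F$ is a topological groupoid, $G$ is an étale groupoid and $\pi$ is an open continuous functor that is injective on units. A slice-section of $\pi$ is a continuous map $a$ into $F$ whose domain $\mathrm{dom}(a)$ is an open slice of $G$ and such that $\pi(a(g))=g$ for all $g\in\mathrm{dom}(a)$. $\mathcal{S}(\pi)$ is the semigroup of all slice-sections with product $ab(gh)=a(g)b(h)$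 for $g\in\mathrm{dom}(a)$, $h\in\mathrm{dom}(b)$ with $gh$ defined (so $\mathrm{dom}(ab)=\mathrm{dom}(a)\mathrm{dom}(b)$). Relations: a relation $\phi\subseteq G\times H$ is viewed as going from $H$ to $G$; $g\mathrel{\phi}h$ means $(g,h)\in\phi$; $\phi^{-1}[G']=\{h\in H:\exists g\in G'\,(g\mathrel{\phi}h)\}$; $x\mathrel{(\phi\circ\psi)}i$ iff $x\mathrel{\phi}h\mathrel{\psi}i$ for some $h$; functions $f$ are identified with relations via $x\mathrel{f}y\Leftrightarrow x=f(y)$. For groupoids $G,H$, $\phi$ is functorial if $g\mathrel\phi h$ implies $g^{-1}\mathrel\phi h^{-1}$, and $g\mathrel\phi h$, $g'\mathrel\phi h'$, $\mathsf{s}(h)=\mathsf{r}(h')$ imply $\mathsf{s}(g)=\mathsf{r}(g')$ and $gg'\mathrel\phi hh'$. A functorial $\phi$ is star-bijective if whenever $g\in G$ and $\mathsf{r}(g)\mathrel\phi h\in H^0$, there is precisely one $i\in H$ with $\mathsf{r}(i)=h$ and $g\mathrel\phi i$. $\phi$ is continuous if $\phi^{-1}[O]$ is open for every open $O\subseteq G$. A Zakrzewski morphism $\phi\subseteq G\times H$ between étale groupoids is a continuous star-bijective functorial relation. For a groupoid bundle $\pi:F\to G$ and a Zakrzewski morphism $\phi\subseteq G\times H$, let $\phi^\pi F=\{(f,h)\in F\times H:\pi(f)\mathrel\phi h\}$, a topological groupoid (subspace topology) under $(f,h)(f',h')=(ff',hh')$ when $hh'$ is defined, and let $\pi_\phi(f,h)=h$.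 A Zakrzewski-Pierce morphism from $\pi:F\to G$ to $\pi':F'\to G'$ is a pair $(\phi,\tau)$ where $\phi\subseteq G\times G'$ is a Zakrzewski morphism, $\tau:\phi^\pi F\to F'$ is a continuous functor and $\pi'\circ\tau=\pi_\phi$. *)

theory Defs
  imports "HOL-Analysis.Analysis"
begin

section \<open>Groupoids as sets of arrows\<close>

record 'a groupoid_data =
  arr :: "'a set"
  mul :: "'a \<Rightarrow> 'a \<Rightarrow> 'a" (infixl "\<cdot>\<index>" 70)
  ginv :: "'a \<Rightarrow> 'a"

definition src :: "('a, 'x) groupoid_data_scheme \<Rightarrow> 'a \<Rightarrow> 'a" where
  "src G g = ginv G g \<cdot>\<^bsub>G\<^esub> g"

definition rng :: "('a, 'x) groupoid_data_scheme \<Rightarrow> 'a \<Rightarrow> 'a" where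
  "rng G g = g \<cdot>\<^bsub>G\<^esub> ginv G g"

definition units :: "('a, 'x) groupoid_data_scheme \<Rightarrow> 'a set" where
  "units G = src G ` arr G"

text \<open>The product of two arrows is only meaningful when the source of the first is the range of
  the second; values of \<^const>\<open>mul\<close> on other pairs are arbitrary and never used. The axioms are those of
  a small category in which every arrow \<open>g\<close> is invertible with inverse \<open>ginv G g\<close>, objects
  being identified with unit arrows.\<close>

locale groupoid =
  fixes G :: "('a, 'x) groupoid_data_scheme" (structure)
  assumes ginv_closed: "g \<in> arr G \<Longrightarrow> ginv G g \<in> arr G"
    and ginv_ginv: "g \<in> arr G \<Longrightarrow> ginv G (ginv G g) = g"
    and mul_closed: "\<lbrakk>g \<in> arr G; h \<in> arr G; src G g = rng G h\<rbrakk> \<Longrightarrow> g \<cdot> h \<in> arr G"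
    and src_mul: "\<lbrakk>g \<in> arr G; h \<in> arr G; src G g = rng G h\<rbrakk> \<Longrightarrow> src G (g \<cdot> h) = src G h"
    and rng_mul: "\<lbrakk>g \<in> arr G; h \<in> arr G; src G g = rng G h\<rbrakk> \<Longrightarrow> rng G (g \<cdot> h) = rng G g"
    and mul_assoc: "\<lbrakk>g \<in> arr G; h \<in> arr G; k \<in> arr G; src G g = rng G h; src G h = rng G k\<rbrakk>
      \<Longrightarrow> (g \<cdot> h) \<cdot> k = g \<cdot> (h \<cdot> k)"
    and mul_src: "g \<in> arr G \<Longrightarrow> g \<cdot> src G g = g"
    and rng_mul_left: "g \<in> arr G \<Longrightarrow> rng G g \<cdot> g = g"

definition slice :: "('a, 'x) groupoid_data_scheme \<Rightarrow> 'a set \<Rightarrow> bool" where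
  "slice G U \<longleftrightarrow> U \<subseteq> arr G \<and> inj_on (src G) U \<and> inj_on (rng G) U"

definition groupoid_functor ::
  "('a, 'x) groupoid_data_scheme \<Rightarrow> ('b, 'y) groupoid_data_scheme \<Rightarrow> ('a \<Rightarrow> 'b) \<Rightarrow> bool" where
  "groupoid_functor F G f \<longleftrightarrow>
     f ` arr F \<subseteq> arr G \<and>
     (\<forall>x\<in>arr F. f (src F x) = src G (f x) \<and> f (rng F x) = rng G (f x)) \<and>
     (\<forall>x\<in>arr F. \<forall>y\<in>arr F. src F x = rng F y \<longrightarrow> f (x \<cdot>\<^bsub>F\<^esub> y) = f x \<cdot>\<^bsub>G\<^esub> f y)"


section \<open>Topological groupoids and groupoid bundles\<close>

record 'a top_groupoid_data = "'a groupoid_data" +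
  gtop :: "'a topology"

definition composable :: "('a, 'x) groupoid_data_scheme \<Rightarrow> ('a \<times> 'a) set" where
  "composable G = {(g, h). g \<in> arr G \<and> h \<in> arr G \<and> src G g = rng G h}"

definition topological_groupoid :: "'a top_groupoid_data \<Rightarrow> bool" where
  "topological_groupoid G \<longleftrightarrow>
     groupoid G \<and> topspace (gtop G) = arr G \<and>
     continuous_map (gtop G) (gtop G) (ginv G) \<and>
     continuous_map (subtopology (prod_topology (gtop G) (gtop G)) (composable G)) (gtop G)
       (\<lambda>(g, h). g \<cdot>\<^bsub>G\<^esub> h)"

definition etale_groupoid :: "'a top_groupoid_data \<Rightarrow> bool" where
  "etale_groupoid G \<longleftrightarrow> topological_groupoid G \<and> open_map (gtop G) (gtop G) (src G)"

definition groupoid_bundle ::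
  "'f top_groupoid_data \<Rightarrow> 'g top_groupoid_data \<Rightarrow> ('f \<Rightarrow> 'g) \<Rightarrow> bool" where
  "groupoid_bundle F G \<pi> \<longleftrightarrow>
     topological_groupoid F \<and> etale_groupoid G \<and>
     open_map (gtop F) (gtop G) \<pi> \<and> continuous_map (gtop F) (gtop G) \<pi> \<and>
     groupoid_functor F G \<pi> \<and> inj_on \<pi> (units F)"


section \<open>Slice-sections\<close>

definition slice_sections ::
  "'f top_groupoid_data \<Rightarrow> 'g top_groupoid_data \<Rightarrow> ('f \<Rightarrow> 'g) \<Rightarrow> ('g \<rightharpoonup> 'f) set" where
  "slice_sections F G \<pi> =
     {a. openin (gtop G) (dom a) \<and> slice G (dom a) \<and>
         continuous_map (subtopology (gtop G) (dom a)) (gtop F) (\<lambda>g. the (a g)) \<and>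
         (\<forall>g\<in>dom a. \<pi> (the (a g)) = g)}"

text \<open>As \<open>dom a\<close> and \<open>dom b\<close> are slices, the factorisation \<open>k = gh\<close> below is unique when it exists;
  see \<open>section_mul_apply\<close>.\<close>

definition section_mul ::
  "'f top_groupoid_data \<Rightarrow> 'g top_groupoid_data \<Rightarrow> ('g \<rightharpoonup> 'f) \<Rightarrow> ('g \<rightharpoonup> 'f) \<Rightarrow> ('g \<rightharpoonup> 'f)" where
  "section_mul F G a b = (\<lambda>k.
     if \<exists>g\<in>dom a. \<exists>h\<in>dom b. src G g = rng G h \<and> k = g \<cdot>\<^bsub>G\<^esub> h
     then Some (THE f. \<exists>g\<in>dom a. \<exists>h\<in>dom b. src G g = rng G h \<and> k = g \<cdot>\<^bsub>G\<^esub> h \<and>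
                         f = the (a g) \<cdot>\<^bsub>F\<^esub> the (b h))
     else None)"

lemma section_mul_apply:
  assumes "groupoid G" "slice G (dom a)" "slice G (dom b)"
    and g: "g \<in> dom a" and h: "h \<in> dom b" and gh: "src G g = rng G h"
  shows "section_mul F G a b (g \<cdot>\<^bsub>G\<^esub> h) = Some (the (a g) \<cdot>\<^bsub>F\<^esub> the (b h))"
proof -
  interpret groupoid G by fact
  have uniq: "g' = g \<and> h' = h"
    if "g' \<in> dom a" "h' \<in> dom b" "src G g' = rng G h'" "g \<cdot>\<^bsub>G\<^esub> h = g' \<cdot>\<^bsub>G\<^esub> h'" for g' h'
  proof -
    have arrs: "g \<in> arr G" "h \<in> arr G" "g' \<in> arr G" "h' \<in> arr G"
      using assms that by (auto simp: slice_def)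
    have "rng G g = rng G g'" "src G h = src G h'"
      using rng_mul[OF arrs(1,2) gh] rng_mul[OF arrs(3,4) that(3)]
        src_mul[OF arrs(1,2) gh] src_mul[OF arrs(3,4) that(3)] that(4) by simp_all
    then show ?thesis
      using assms that by (auto simp: slice_def dest: inj_onD)
  qed
  have "(THE f. \<exists>g'\<in>dom a. \<exists>h'\<in>dom b. src G g' = rng G h' \<and> g \<cdot>\<^bsub>G\<^esub> h = g' \<cdot>\<^bsub>G\<^esub> h' \<and>
           f = the (a g') \<cdot>\<^bsub>F\<^esub> the (b h')) = the (a g) \<cdot>\<^bsub>F\<^esub> the (b h)"
  proof (rule the_equality)
    show "\<exists>g'\<in>dom a. \<exists>h'\<in>dom b. src G g' = rng G h' \<and> g \<cdot>\<^bsub>G\<^esub> h = g' \<cdot>\<^bsub>G\<^esub> h' \<and>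
        the (a g) \<cdot>\<^bsub>F\<^esub> the (b h) = the (a g') \<cdot>\<^bsub>F\<^esub> the (b h')"
      using g h gh by blast
  qed (use uniq in blast)
  moreover have "\<exists>g'\<in>dom a. \<exists>h'\<in>dom b. src G g' = rng G h' \<and> g \<cdot>\<^bsub>G\<^esub> h = g' \<cdot>\<^bsub>G\<^esub> h'"
    using g h gh by blast
  ultimately show ?thesis
    by (simp add: section_mul_def)
qed

definition semigroup_on :: "'s set \<Rightarrow> ('s \<Rightarrow> 's \<Rightarrow> 's) \<Rightarrow> bool" where
  "semigroup_on S m \<longleftrightarrow>
     (\<forall>a\<in>S. \<forall>b\<in>S. m a b \<in> S) \<and>
     (\<forall>a\<in>S. \<forall>b\<in>S. \<forall>c\<in>S. m (m a b) c = m a (m b c))"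

definition semigroup_hom ::
  "'s set \<Rightarrow> ('s \<Rightarrow> 's \<Rightarrow> 's) \<Rightarrow> 't set \<Rightarrow> ('t \<Rightarrow> 't \<Rightarrow> 't) \<Rightarrow> ('s \<Rightarrow> 't) \<Rightarrow> bool" where
  "semigroup_hom S m T n \<Phi> \<longleftrightarrow>
     semigroup_on S m \<and> semigroup_on T n \<and>
     (\<forall>a\<in>S. \<Phi> a \<in> T) \<and> (\<forall>a\<in>S. \<forall>b\<in>S. \<Phi> (m a b) = n (\<Phi> a) (\<Phi> b))"


section \<open>Zakrzewski morphisms\<close>

text \<open>A relation \<open>\<phi> \<subseteq> G \<times> H\<close> is regarded as going from \<open>H\<close> to \<open>G\<close>. In this convention composition of
  relations is \<^const>\<open>relcomp\<close> without any reversal, and the preimage of \<open>O \<subseteq> G\<close> under \<open>\<phi>\<close> is the set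
  of all \<open>h\<close> related to some \<open>g \<in> O\<close>, i.e. \<open>\<phi> `` O\<close>.\<close>

definition functorial ::
  "('g, 'x) groupoid_data_scheme \<Rightarrow> ('h, 'y) groupoid_data_scheme \<Rightarrow> ('g \<times> 'h) set \<Rightarrow> bool" where
  "functorial G H \<phi> \<longleftrightarrow>
     \<phi> \<subseteq> arr G \<times> arr H \<and>
     (\<forall>g h. (g, h) \<in> \<phi> \<longrightarrow> (ginv G g, ginv H h) \<in> \<phi>) \<and>
     (\<forall>g h g' h'. (g, h) \<in> \<phi> \<and> (g', h') \<in> \<phi> \<and> src H h = rng H h' \<longrightarrow>
        src G g = rng G g' \<and> (g \<cdot>\<^bsub>G\<^esub> g', h \<cdot>\<^bsub>H\<^esub> h') \<in> \<phi>)"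

definition star_bijective ::
  "('g, 'x) groupoid_data_scheme \<Rightarrow> ('h, 'y) groupoid_data_scheme \<Rightarrow> ('g \<times> 'h) set \<Rightarrow> bool" where
  "star_bijective G H \<phi> \<longleftrightarrow>
     (\<forall>g\<in>arr G. \<forall>h\<in>units H. (rng G g, h) \<in> \<phi> \<longrightarrow>
        (\<exists>!i. i \<in> arr H \<and> rng H i = h \<and> (g, i) \<in> \<phi>))"

definition zakrzewski_morphism ::
  "'g top_groupoid_data \<Rightarrow> 'h top_groupoid_data \<Rightarrow> ('g \<times> 'h) set \<Rightarrow> bool" where
  "zakrzewski_morphism G H \<phi> \<longleftrightarrow>
     etale_groupoid G \<and> etale_groupoid H \<and>
     functorial G H \<phi> \<and> star_bijective G H \<phi> \<and>
     (\<forall>U. openin (gtop G) U \<longrightarrow> openin (gtop H) (\<phi> `` U))"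


section \<open>Zakrzewski-Pierce morphisms\<close>

text \<open>Under the hypotheses in force, two elements of the pullback are composable exactly when their
  second components are; see \<open>pullback_composable\<close>.\<close>

definition pullback_arrows ::
  "'f top_groupoid_data \<Rightarrow> ('f \<Rightarrow> 'g) \<Rightarrow> 'h top_groupoid_data \<Rightarrow> ('g \<times> 'h) set \<Rightarrow> ('f \<times> 'h) set" where
  "pullback_arrows F \<pi> H \<phi> = {(f, h). f \<in> arr F \<and> h \<in> arr H \<and> (\<pi> f, h) \<in> \<phi>}"

definition pullback ::
  "'f top_groupoid_data \<Rightarrow> ('f \<Rightarrow> 'g) \<Rightarrow> 'h top_groupoid_data \<Rightarrow> ('g \<times> 'h) set
     \<Rightarrow> ('f \<times> 'h) top_groupoid_data" where
  "pullback F \<pi> H \<phi> =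
     \<lparr>arr = pullback_arrows F \<pi> H \<phi>,
      mul = (\<lambda>(f, h) (f', h'). (f \<cdot>\<^bsub>F\<^esub> f', h \<cdot>\<^bsub>H\<^esub> h')),
      ginv = (\<lambda>(f, h). (ginv F f, ginv H h)),
      gtop = subtopology (prod_topology (gtop F) (gtop H)) (pullback_arrows F \<pi> H \<phi>)\<rparr>"

lemma pullback_composable:
  assumes bun: "groupoid_bundle F G \<pi>" and zm: "zakrzewski_morphism G H \<phi>"
    and p: "(f, h) \<in> arr (pullback F \<pi> H \<phi>)" and q: "(f', h') \<in> arr (pullback F \<pi> H \<phi>)"
  shows "src (pullback F \<pi> H \<phi>) (f, h) = rng (pullback F \<pi> H \<phi>) (f', h') \<longleftrightarrow> src H h = rng H h'"
proof -
  interpret F: groupoid F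
    using bun by (simp add: groupoid_bundle_def topological_groupoid_def)
  have arrs: "f \<in> arr F" "f' \<in> arr F" "(\<pi> f, h) \<in> \<phi>" "(\<pi> f', h') \<in> \<phi>"
    using p q by (simp_all add: pullback_def pullback_arrows_def)
  have "src F f = rng F f'" if "src H h = rng H h'"
  proof -
    have "src G (\<pi> f) = rng G (\<pi> f')"
      using zm arrs that by (auto simp: zakrzewski_morphism_def functorial_def)
    then have "\<pi> (src F f) = \<pi> (rng F f')"
      using bun arrs by (simp add: groupoid_bundle_def groupoid_functor_def)
    moreover have "rng F f' = src F (ginv F f')"
      using arrs by (simp add: src_def rng_def F.ginv_ginv)
    then have "rng F f' \<in> units F"
      using arrs F.ginv_closed by (auto simp: units_def)
    moreover have "src F f \<in> units F"
      using arrs by (auto simp: units_def)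
    ultimately show ?thesis
      using bun by (auto simp: groupoid_bundle_def dest: inj_onD)
  qed
  then show ?thesis
    by (auto simp: src_def rng_def pullback_def)
qed

definition zakrzewski_pierce_morphism ::
  "'f top_groupoid_data \<Rightarrow> 'g top_groupoid_data \<Rightarrow> ('f \<Rightarrow> 'g) \<Rightarrow>
   'f2 top_groupoid_data \<Rightarrow> 'g2 top_groupoid_data \<Rightarrow> ('f2 \<Rightarrow> 'g2) \<Rightarrow>
   ('g \<times> 'g2) set \<Rightarrow> ('f \<times> 'g2 \<Rightarrow> 'f2) \<Rightarrow> bool" where
  "zakrzewski_pierce_morphism F G \<pi> F' G' \<pi>' \<phi> \<tau> \<longleftrightarrow>
     zakrzewski_morphism G G' \<phi> \<and>
     continuous_map (gtop (pullback F \<pi> G' \<phi>)) (gtop F') \<tau> \<and>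
     groupoid_functor (pullback F \<pi> G' \<phi>) F' \<tau> \<and>
     (\<forall>p\<in>arr (pullback F \<pi> G' \<phi>). \<pi>' (\<tau> p) = snd p)"


section \<open>Functions as relations\<close>

text \<open>A partial function \<open>f\<close> is identified with the relation of all pairs \<open>(f y, y)\<close> (value first).\<close>

definition map_rel :: "('b \<rightharpoonup> 'a) \<Rightarrow> ('a \<times> 'b) set" where
  "map_rel f = (Map.graph f)\<inverse>"

definition function_on :: "('b \<Rightarrow> 'a) \<Rightarrow> 'b set \<Rightarrow> ('b \<rightharpoonup> 'a)" where
  "function_on f D = (\<lambda>y. Some (f y)) |` D"

definition rel_times :: "('a \<times> 'c) set \<Rightarrow> ('b \<times> 'd) set \<Rightarrow> (('a \<times> 'b) \<times> ('c \<times> 'd)) set" where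
  "rel_times R S = {((x, y), (x', y')). (x, x') \<in> R \<and> (y, y') \<in> S}"

definition functional :: "('a \<times> 'b) set \<Rightarrow> bool" where
  "functional R \<longleftrightarrow> single_valued (R\<inverse>)"

text \<open>Only meaningful if \<open>R\<close> is functional and \<open>y\<close> lies in its domain.\<close>

definition rel_value :: "('a \<times> 'b) set \<Rightarrow> 'b \<Rightarrow> 'a" where
  "rel_value R y = (THE x. (x, y) \<in> R)"

end

theory Submission
  imports Defs
begin

text \<open>
  The argument rests on arrows that are uniquely determined by others, once inside a groupoid and once
  across \<open>\<phi>\<close>, and on the fact that they depend continuously on the arrows that determine them.

  Inside the semigroups, an arrow \<open>k\<close> of a product \<open>UV\<close> of open slices factors uniquely as \<open>k = gh\<close>:
  the left factor \<open>g\<close> is the only arrow of \<open>U\<close> with the range of \<open>k\<close>, and \<open>h = g\<^sup>-\<^sup>1k\<close>. Since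
  the range map is open, \<open>g\<close> depends continuously on \<open>k\<close>, hence so does \<open>h\<close>. This
  exhibits \<open>UV\<close> as the preimage of \<open>V\<close> under a continuous map with open domain, so that \<open>UV\<close> is open, and
  it exhibits \<open>ab\<close> as the continuous map \<open>k \<mapsto> a(g) b(h)\<close>.

  Across \<open>\<phi>\<close>, functoriality forces any two arrows related to the same \<open>h\<close> to have the same range, so an
  open slice \<open>U\<close> contains at most one \<open>g\<close> with \<open>(g, h) \<in> \<phi>\<close>. Its dependence on \<open>h\<close> is continuous because the
  preimage of an open \<open>O\<close> is \<open>\<phi> `` (O \<inter> U)\<close>, and so \<open>h \<mapsto> \<tau>(a(g), h)\<close> is a continuous section. The
  uniqueness half of star-bijectivity makes its domain \<open>\<phi> `` U\<close> a slice.
  The existence half gives multiplicativity: if \<open>(gh, k) \<in> \<phi>\<close>, then \<open>g\<close> lifts to some \<open>k\<^sub>1\<close> with the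
  range of \<open>k\<close>, whence \<open>k = k\<^sub>1k\<^sub>2\<close> with \<open>k\<^sub>2 = k\<^sub>1\<^sup>-\<^sup>1k\<close> related to \<open>h\<close>, and \<open>\<tau>\<close> is a functor.
\<close>

section \<open>Continuity of uniquely determined partners\<close>

text \<open>The common source of continuity: it is used for the partner under \<open>\<phi>\<close> in a slice, and for the
  arrow of a slice with a prescribed range. The preimage of an open set \<open>W\<close> under \<open>s\<close> is \<open>R `` (W \<inter> U)\<close>.\<close>

lemma continuous_map_unique_partner:
  assumes U: "openin X U"
    and R_open: "\<And>W. openin X W \<Longrightarrow> openin Y (R `` W)"
    and partner: "\<And>u y. (u, y) \<in> R \<Longrightarrow> u \<in> U \<Longrightarrow> s y = u"
  shows "continuous_map (subtopology Y (R `` U)) (subtopology X U) s"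
proof -
  have carrier: "R `` U \<subseteq> topspace Y"
    using R_open[OF U] openin_subset by blast
  have "openin (subtopology Y (R `` U)) {y \<in> topspace (subtopology Y (R `` U)). s y \<in> W}"
    if W: "openin X W" for W
  proof -
    have "{y \<in> topspace (subtopology Y (R `` U)). s y \<in> W} = R `` (W \<inter> U)"
      using partner carrier by auto
    moreover have "openin Y (R `` (W \<inter> U))"
      using W U by (intro R_open openin_Int)
    ultimately show ?thesis
      using R_open[OF U] by (auto simp: openin_open_subtopology)
  qed
  moreover have s_U: "s y \<in> U" if "y \<in> R `` U" for y
    using that partner by auto
  then have "s \<in> topspace (subtopology Y (R `` U)) \<rightarrow> topspace X"
    using openin_subset[OF U] by auto
  ultimately have "continuous_map (subtopology Y (R `` U)) X s"
    by (auto simp only: continuous_map_def)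
  then show ?thesis
    using s_U by (simp add: continuous_map_in_subtopology image_subset_iff)
qed

lemma continuous_map_pair_into_subtopology:
  assumes "continuous_map X Y f" "continuous_map X Z g" "\<And>x. x \<in> topspace X \<Longrightarrow> (f x, g x) \<in> S"
  shows "continuous_map X (subtopology (prod_topology Y Z) S) (\<lambda>x. (f x, g x))"
  using assms by (simp add: continuous_map_in_subtopology continuous_map_pairedI image_subset_iff)


section \<open>Arrows of a groupoid\<close>

lemma slice_src_eq: "slice G U \<Longrightarrow> g \<in> U \<Longrightarrow> h \<in> U \<Longrightarrow> src G g = src G h \<Longrightarrow> g = h"
  by (auto simp: slice_def dest: inj_onD)

lemma slice_rng_eq: "slice G U \<Longrightarrow> g \<in> U \<Longrightarrow> h \<in> U \<Longrightarrow> rng G g = rng G h \<Longrightarrow> g = h"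
  by (auto simp: slice_def dest: inj_onD)

context groupoid
begin

lemma src_ginv: "g \<in> arr G \<Longrightarrow> src G (ginv G g) = rng G g"
  by (simp add: src_def rng_def ginv_ginv)

lemma rng_ginv: "g \<in> arr G \<Longrightarrow> rng G (ginv G g) = src G g"
  by (simp add: src_def rng_def ginv_ginv)

lemma src_in_units: "g \<in> arr G \<Longrightarrow> src G g \<in> units G"
  by (simp add: units_def)

lemma rng_in_units: "g \<in> arr G \<Longrightarrow> rng G g \<in> units G"
  using src_in_units[OF ginv_closed] src_ginv by simp

lemma ginv_mul_cancel:
  assumes "g \<in> arr G" "h \<in> arr G" "src G g = rng G h"
  shows "ginv G g \<cdot> (g \<cdot> h) = h"
proof -
  have "ginv G g \<cdot> (g \<cdot> h) = (ginv G g \<cdot> g) \<cdot> h"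
    using assms by (simp add: mul_assoc ginv_closed src_ginv)
  then show ?thesis
    using assms by (simp add: src_def[symmetric] rng_mul_left)
qed

text \<open>The source of all factorisations below: the right factor of an arrow of \<open>UV\<close>, and the second factor
  when a product is lifted along \<open>\<phi>\<close>.\<close>

lemma left_quotient:
  assumes "g \<in> arr G" "k \<in> arr G" "rng G g = rng G k"
  shows "ginv G g \<cdot> k \<in> arr G" "rng G (ginv G g \<cdot> k) = src G g" "g \<cdot> (ginv G g \<cdot> k) = k"
proof -
  have comp: "src G (ginv G g) = rng G k"
    using assms by (simp add: src_ginv)
  show "ginv G g \<cdot> k \<in> arr G" "rng G (ginv G g \<cdot> k) = src G g"
    using assms comp by (simp_all add: mul_closed rng_mul ginv_closed rng_ginv)
  show "g \<cdot> (ginv G g \<cdot> k) = k"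
    using ginv_mul_cancel[of "ginv G g" k] assms comp by (simp add: ginv_closed ginv_ginv)
qed

text \<open>The source of \<open>gh\<close> determines \<open>h\<close>, whose range is the source of \<open>g\<close> and so determines \<open>g\<close>; dually for
  the range of \<open>gh\<close>.\<close>

lemma slice_product:
  assumes U: "slice G U" and V: "slice G V"
  shows "slice G {g \<cdot> h |g h. g \<in> U \<and> h \<in> V \<and> src G g = rng G h}"
proof -
  have sub: "U \<subseteq> arr G" "V \<subseteq> arr G"
    using U V by (auto simp: slice_def)
  have eq: "g = g' \<and> h = h'"
    if m: "g \<in> U" "h \<in> V" "src G g = rng G h" "g' \<in> U" "h' \<in> V" "src G g' = rng G h'"
      and e: "src G h = src G h' \<or> rng G g = rng G g'" for g h g' h'
    using e
  proof
    assume "src G h = src G h'"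
    then have "h = h'" by (rule slice_src_eq[OF V m(2,5)])
    then have "src G g = src G g'" using m by simp
    then show ?thesis using \<open>h = h'\<close> slice_src_eq[OF U m(1,4)] by blast
  next
    assume "rng G g = rng G g'"
    then have "g = g'" by (rule slice_rng_eq[OF U m(1,4)])
    then have "rng G h = rng G h'" using m by simp
    then show ?thesis using \<open>g = g'\<close> slice_rng_eq[OF V m(2,5)] by blast
  qed
  have inj_prod: "k = k'"
    if k: "k = g \<cdot> h" "g \<in> U" "h \<in> V" "src G g = rng G h"
      and k': "k' = g' \<cdot> h'" "g' \<in> U" "h' \<in> V" "src G g' = rng G h'"
      and e: "src G k = src G k' \<or> rng G k = rng G k'" for k k' g h g' h'
  proof -
    have "src G k = src G h" "rng G k = rng G g" "src G k' = src G h'" "rng G k' = rng G g'"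
      using k k' sub by (auto simp: src_mul rng_mul subset_iff)
    then show ?thesis
      using eq[of g h g' h'] k k' e by auto
  qed
  show ?thesis
    unfolding slice_def
  proof (intro conjI inj_onI)
    show "{g \<cdot> h |g h. g \<in> U \<and> h \<in> V \<and> src G g = rng G h} \<subseteq> arr G"
      using sub by (auto intro: mul_closed)
  qed (use inj_prod in blast)+
qed

end


section \<open>Continuous factorisation in an open slice\<close>

lemma etale_continuous_rng:
  assumes "etale_groupoid G"
  shows "continuous_map (gtop G) (gtop G) (rng G)"
proof -
  interpret groupoid G
    using assms by (simp add: etale_groupoid_def topological_groupoid_def)
  have G: "topspace (gtop G) = arr G" "continuous_map (gtop G) (gtop G) (ginv G)"
    "continuous_map (subtopology (prod_topology (gtop G) (gtop G)) (composable G)) (gtop G)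
       (\<lambda>(g, h). g \<cdot>\<^bsub>G\<^esub> h)"
    using assms by (auto simp: etale_groupoid_def topological_groupoid_def)
  have "continuous_map (gtop G) (subtopology (prod_topology (gtop G) (gtop G)) (composable G))
          (\<lambda>g. (g, ginv G g))"
    using G by (intro continuous_map_pair_into_subtopology)
      (simp_all add: composable_def ginv_closed rng_ginv)
  from continuous_map_compose[OF this G(3)] show ?thesis
    by (simp add: o_def rng_def[abs_def])
qed

lemma etale_open_rng:
  assumes "etale_groupoid G"
  shows "open_map (gtop G) (gtop G) (rng G)"
  unfolding open_map_def
proof (intro allI impI)
  interpret groupoid G
    using assms by (simp add: etale_groupoid_def topological_groupoid_def)
  fix W assume W: "openin (gtop G) W"
  have G: "topspace (gtop G) = arr G" "continuous_map (gtop G) (gtop G) (ginv G)"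
    "open_map (gtop G) (gtop G) (src G)"
    using assms by (auto simp: etale_groupoid_def topological_groupoid_def)
  have W_sub: "W \<subseteq> arr G"
    using W G(1) openin_subset by metis
  \<comment> \<open>Inversion is an involution, so the inverse image of \<open>W\<close> is also its image.\<close>
  let ?W' = "{g \<in> topspace (gtop G). ginv G g \<in> W}"
  have "openin (gtop G) (src G ` ?W')"
    using openin_continuous_map_preimage[OF G(2) W] G(3) by (simp add: open_map_def)
  moreover have "src G ` ?W' = rng G ` W"
  proof
    show "src G ` ?W' \<subseteq> rng G ` W"
    proof
      fix u assume "u \<in> src G ` ?W'"
      then obtain g where "ginv G g \<in> W" "u = rng G (ginv G g)"
        using G(1) by (auto simp: rng_ginv)
      then show "u \<in> rng G ` W" by blast
    qed
    show "rng G ` W \<subseteq> src G ` ?W'"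
    proof
      fix u assume "u \<in> rng G ` W"
      then obtain g where "g \<in> W" "u = rng G g" by blast
      then have "ginv G g \<in> ?W'" "u = src G (ginv G g)"
        using W_sub G(1) by (auto simp: ginv_closed ginv_ginv src_ginv subset_iff)
      then show "u \<in> src G ` ?W'" by blast
    qed
  qed
  ultimately show "openin (gtop G) (rng G ` W)" by simp
qed

definition left_factor :: "('a, 'x) groupoid_data_scheme \<Rightarrow> 'a set \<Rightarrow> 'a \<Rightarrow> 'a" where
  "left_factor G U k = inv_into U (rng G) (rng G k)"

text \<open>Written as a relation so that the arrows with a left factor in \<open>U\<close> form the image
  \<open>same_rng G `` U\<close>, as continuity of uniquely determined partners requires.\<close>

definition same_rng :: "('a, 'x) groupoid_data_scheme \<Rightarrow> ('a \<times> 'a) set" where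
  "same_rng G = {(g, k). g \<in> arr G \<and> k \<in> arr G \<and> rng G g = rng G k}"

lemma left_factor_eq:
  assumes "slice G U" "g \<in> U" "rng G g = rng G k"
  shows "left_factor G U k = g"
  using assms by (metis left_factor_def inv_into_f_f slice_def)

lemma openin_same_rng_image:
  assumes G: "etale_groupoid G" and W: "openin (gtop G) W"
  shows "openin (gtop G) (same_rng G `` W)"
proof -
  have top: "topspace (gtop G) = arr G"
    using G by (simp add: etale_groupoid_def topological_groupoid_def)
  have "k \<in> same_rng G `` W \<longleftrightarrow> k \<in> arr G \<and> rng G k \<in> rng G ` W" for k
    using openin_subset[OF W] top by (simp add: same_rng_def image_iff Image_iff) (metis subsetD)
  then have *: "same_rng G `` W = {k \<in> topspace (gtop G). rng G k \<in> rng G ` W}"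
    using top by blast
  have "openin (gtop G) (rng G ` W)"
    using etale_open_rng[OF G] W by (simp add: open_map_def)
  from openin_continuous_map_preimage[OF etale_continuous_rng[OF G] this]
  show ?thesis
    using * by simp
qed

lemma continuous_left_factor:
  assumes G: "etale_groupoid G" and U: "openin (gtop G) U" "slice G U"
  shows "continuous_map (subtopology (gtop G) (same_rng G `` U)) (subtopology (gtop G) U)
           (left_factor G U)"
proof (intro continuous_map_unique_partner U(1) openin_same_rng_image[OF G])
  show "left_factor G U k = g" if "(g, k) \<in> same_rng G" "g \<in> U" for g k
    using that by (intro left_factor_eq[OF U(2)]) (simp_all add: same_rng_def)
qed

lemma continuous_right_factor:
  assumes G: "etale_groupoid G" and U: "openin (gtop G) U" "slice G U"
  shows "continuous_map (subtopology (gtop G) (same_rng G `` U)) (gtop G)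
           (\<lambda>k. ginv G (left_factor G U k) \<cdot>\<^bsub>G\<^esub> k)"
proof -
  interpret groupoid G
    using G by (simp add: etale_groupoid_def topological_groupoid_def)
  have Gt: "topspace (gtop G) = arr G" "continuous_map (gtop G) (gtop G) (ginv G)"
    "continuous_map (subtopology (prod_topology (gtop G) (gtop G)) (composable G)) (gtop G)
       (\<lambda>(g, h). g \<cdot>\<^bsub>G\<^esub> h)"
    using G by (auto simp: etale_groupoid_def topological_groupoid_def)
  let ?D = "subtopology (gtop G) (same_rng G `` U)"
  have "continuous_map ?D (gtop G) (left_factor G U)"
    using continuous_left_factor[OF G U] by (simp add: continuous_map_in_subtopology)
  from continuous_map_compose[OF this Gt(2)]
  have "continuous_map ?D (gtop G) (\<lambda>k. ginv G (left_factor G U k))"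
    by (simp add: o_def)
  moreover have "continuous_map ?D (gtop G) (\<lambda>k. k)"
    by (simp add: continuous_map_from_subtopology)
  moreover have "(ginv G (left_factor G U k), k) \<in> composable G" if k: "k \<in> same_rng G `` U" for k
  proof -
    obtain g where g: "g \<in> U" "g \<in> arr G" "k \<in> arr G" "rng G g = rng G k"
      using k unfolding same_rng_def by blast
    then have "left_factor G U k = g"
      by (intro left_factor_eq[OF U(2)])
    then show ?thesis
      using g by (simp add: composable_def ginv_closed src_ginv)
  qed
  ultimately have "continuous_map ?D
      (subtopology (prod_topology (gtop G) (gtop G)) (composable G))
      (\<lambda>k. (ginv G (left_factor G U k), k))"
    by (intro continuous_map_pair_into_subtopology) simp_all
  from continuous_map_compose[OF this Gt(3)] show ?thesis
    by (simp add: o_def)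
qed

text \<open>This form of \<open>UV\<close> makes it visibly open: it is the preimage of \<open>V\<close> under the right factor, by
  \<open>g\<^sup>-\<^sup>1(gh) = h\<close> in one direction and \<open>g(g\<^sup>-\<^sup>1k) = k\<close> in the other.\<close>

lemma slice_product_eq:
  assumes "groupoid G" and U: "slice G U" and V: "V \<subseteq> arr G"
  shows "{g \<cdot>\<^bsub>G\<^esub> h |g h. g \<in> U \<and> h \<in> V \<and> src G g = rng G h} =
         {k \<in> same_rng G `` U. ginv G (left_factor G U k) \<cdot>\<^bsub>G\<^esub> k \<in> V}"
    (is "?UV = ?P")
proof
  interpret groupoid G by fact
  have sub: "U \<subseteq> arr G"
    using U by (simp add: slice_def)
  show "?UV \<subseteq> ?P"
  proof
    fix k assume "k \<in> ?UV"
    then obtain g h where k: "k = g \<cdot>\<^bsub>G\<^esub> h" "g \<in> U" "h \<in> V" "src G g = rng G h" by blast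
    then have arrs: "g \<in> arr G" "h \<in> arr G" using sub V by auto
    then have "rng G k = rng G g" "k \<in> arr G"
      using k by (simp_all add: rng_mul mul_closed)
    moreover from this have "left_factor G U k = g"
      using k by (intro left_factor_eq[OF U]) simp_all
    moreover from calculation have "k \<in> same_rng G `` U"
      using k arrs unfolding same_rng_def by auto
    ultimately show "k \<in> ?P"
      using k arrs by (simp add: ginv_mul_cancel)
  qed
  show "?P \<subseteq> ?UV"
  proof
    fix k assume k: "k \<in> ?P"
    then obtain g where g: "g \<in> U" "g \<in> arr G" "k \<in> arr G" "rng G g = rng G k"
      unfolding same_rng_def by blast
    then have "left_factor G U k = g"
      by (intro left_factor_eq[OF U])
    then have "ginv G g \<cdot>\<^bsub>G\<^esub> k \<in> V"
      using k by simp
    then show "k \<in> ?UV"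
      using g(1) left_quotient(2,3)[OF g(2-4)] by (metis (mono_tags, lifting) mem_Collect_eq)
  qed
qed


section \<open>The semigroup of slice-sections\<close>

lemma slice_sectionI:
  assumes "openin (gtop G) (dom a)" "slice G (dom a)"
    "continuous_map (subtopology (gtop G) (dom a)) (gtop F) (\<lambda>g. the (a g))"
    "\<And>g x. a g = Some x \<Longrightarrow> \<pi> x = g"
  shows "a \<in> slice_sections F G \<pi>"
  using assms by (auto simp: slice_sections_def)

lemma slice_sectionD:
  assumes "groupoid_bundle F G \<pi>" "a \<in> slice_sections F G \<pi>"
  shows "openin (gtop G) (dom a)" "slice G (dom a)"
    "continuous_map (subtopology (gtop G) (dom a)) (gtop F) (\<lambda>g. the (a g))"
    "a g = Some x \<Longrightarrow> g \<in> arr G" "a g = Some x \<Longrightarrow> x \<in> arr F" "a g = Some x \<Longrightarrow> \<pi> x = g"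
proof -
  show *: "openin (gtop G) (dom a)" "slice G (dom a)"
    and cont: "continuous_map (subtopology (gtop G) (dom a)) (gtop F) (\<lambda>g. the (a g))"
    using assms(2) by (auto simp: slice_sections_def)
  have top: "topspace (gtop F) = arr F"
    using assms(1) by (simp add: groupoid_bundle_def topological_groupoid_def)
  show "g \<in> arr G" if "a g = Some x"
    using that *(2) by (auto simp: slice_def)
  show "\<pi> x = g" if "a g = Some x"
  proof -
    have "\<pi> (the (a g)) = g"
      using domI[of a g x, OF that] assms(2) unfolding slice_sections_def by blast
    then show ?thesis using that by simp
  qed
  show "x \<in> arr F" if "a g = Some x"
  proof -
    have "g \<in> topspace (subtopology (gtop G) (dom a))"
      using that openin_subset[OF *(1)] by auto
    then have "the (a g) \<in> topspace (gtop F)"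
      using cont unfolding continuous_map_def by (metis Pi_iff)
    then show ?thesis
      using that top by simp
  qed
qed

text \<open>Injectivity on units lets composability in the base be lifted to the total groupoid.\<close>

lemma bundle_composable:
  assumes bun: "groupoid_bundle F G \<pi>"
    and x: "x \<in> arr F" and y: "y \<in> arr F" and base: "src G (\<pi> x) = rng G (\<pi> y)"
  shows "src F x = rng F y"
proof -
  interpret F: groupoid F
    using bun by (simp add: groupoid_bundle_def topological_groupoid_def)
  have "\<pi> (src F x) = \<pi> (rng F y)"
    using bun x y base by (simp add: groupoid_bundle_def groupoid_functor_def)
  then show ?thesis
    using bun F.src_in_units[OF x] F.rng_in_units[OF y]
    by (auto simp: groupoid_bundle_def dest: inj_onD)
qed

lemma section_mul_Some_iff:
  assumes "groupoid G" "slice G (dom a)" "slice G (dom b)"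
  shows "section_mul F G a b k = Some z \<longleftrightarrow>
    (\<exists>g h x y. a g = Some x \<and> b h = Some y \<and> src G g = rng G h \<and>
       k = g \<cdot>\<^bsub>G\<^esub> h \<and> z = x \<cdot>\<^bsub>F\<^esub> y)"
proof
  assume L: "section_mul F G a b k = Some z"
  then obtain g h where gh: "g \<in> dom a" "h \<in> dom b" "src G g = rng G h" "k = g \<cdot>\<^bsub>G\<^esub> h"
    unfolding section_mul_def by (auto split: if_splits)
  then have "z = the (a g) \<cdot>\<^bsub>F\<^esub> the (b h)"
    using L section_mul_apply[OF assms, of g h F] by simp
  with gh show "\<exists>g h x y. a g = Some x \<and> b h = Some y \<and> src G g = rng G h \<and>
       k = g \<cdot>\<^bsub>G\<^esub> h \<and> z = x \<cdot>\<^bsub>F\<^esub> y" by force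
next
  assume "\<exists>g h x y. a g = Some x \<and> b h = Some y \<and> src G g = rng G h \<and>
       k = g \<cdot>\<^bsub>G\<^esub> h \<and> z = x \<cdot>\<^bsub>F\<^esub> y"
  then obtain g h x y where gh: "a g = Some x" "b h = Some y" "src G g = rng G h"
      "k = g \<cdot>\<^bsub>G\<^esub> h" "z = x \<cdot>\<^bsub>F\<^esub> y" by blast
  then show "section_mul F G a b k = Some z"
    using section_mul_apply[OF assms, of g h F] by (simp add: domI)
qed

lemma dom_section_mul:
  assumes "groupoid G" "slice G (dom a)" "slice G (dom b)"
  shows "dom (section_mul F G a b) = {g \<cdot>\<^bsub>G\<^esub> h |g h. g \<in> dom a \<and> h \<in> dom b \<and> src G g = rng G h}"
proof -
  have "k \<in> dom (section_mul F G a b) \<longleftrightarrow> (\<exists>z. section_mul F G a b k = Some z)" for k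
    by auto
  then show ?thesis
    unfolding section_mul_Some_iff[OF assms] by blast
qed

text \<open>Openness of the domain and continuity both come from the continuous factorisation
  \<open>k = gh\<close>: the product section is \<open>k \<mapsto> a(g) b(h)\<close>.\<close>

lemma section_mul_closed:
  assumes bun: "groupoid_bundle F G \<pi>"
    and a: "a \<in> slice_sections F G \<pi>" and b: "b \<in> slice_sections F G \<pi>"
  shows "section_mul F G a b \<in> slice_sections F G \<pi>"
proof -
  have etale: "etale_groupoid G"
    using bun by (simp add: groupoid_bundle_def)
  interpret G: groupoid G
    using etale by (simp add: etale_groupoid_def topological_groupoid_def)
  note a' = slice_sectionD[OF bun a] and b' = slice_sectionD[OF bun b]
  note Some_iff = section_mul_Some_iff[OF G.groupoid_axioms a'(2) b'(2)]
  note dom_eq = dom_section_mul[OF G.groupoid_axioms a'(2) b'(2)]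
  define D where "D = same_rng G `` dom a"
  define l where "l = left_factor G (dom a)"
  define r where "r = (\<lambda>k. ginv G (l k) \<cdot>\<^bsub>G\<^esub> k)"
  define P where "P = {k \<in> D. r k \<in> dom b}"
  have l_cont: "continuous_map (subtopology (gtop G) D) (subtopology (gtop G) (dom a)) l"
    using continuous_left_factor[OF etale a'(1,2)] by (simp add: D_def l_def)
  have r_cont: "continuous_map (subtopology (gtop G) D) (gtop G) r"
    using continuous_right_factor[OF etale a'(1,2)] by (simp add: D_def l_def r_def)
  have dom_P: "dom (section_mul F G a b) = P"
    using b'(2) dom_eq slice_product_eq[OF G.groupoid_axioms a'(2), of "dom b"]
    by (simp add: P_def D_def r_def l_def slice_def)
  have D_open: "openin (gtop G) D"
    using openin_same_rng_image[OF etale a'(1)] by (simp add: D_def)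
  have "P = {k \<in> topspace (subtopology (gtop G) D). r k \<in> dom b}"
    using openin_subset[OF D_open] by (auto simp: P_def)
  then have "openin (subtopology (gtop G) D) P"
    using openin_continuous_map_preimage[OF r_cont b'(1)] by argo
  then have P_open: "openin (gtop G) P"
    using D_open by (simp add: openin_open_subtopology)
  have factor: "l k \<in> dom a" "r k \<in> dom b" "src G (l k) = rng G (r k)" "l k \<cdot>\<^bsub>G\<^esub> r k = k"
    if k: "k \<in> P" for k
  proof -
    obtain g where g: "g \<in> dom a" "g \<in> arr G" "k \<in> arr G" "rng G g = rng G k"
      using k unfolding P_def D_def same_rng_def by blast
    then have "l k = g"
      unfolding l_def by (intro left_factor_eq[OF a'(2)])
    then show "l k \<in> dom a" "src G (l k) = rng G (r k)" "l k \<cdot>\<^bsub>G\<^esub> r k = k"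
      using g by (simp_all add: r_def G.left_quotient)
    show "r k \<in> dom b" using k by (simp add: P_def)
  qed
  have prod_eq: "the (section_mul F G a b k) = the (a (l k)) \<cdot>\<^bsub>F\<^esub> the (b (r k))" if "k \<in> P" for k
    using section_mul_apply[OF G.groupoid_axioms a'(2) b'(2), of "l k" "r k" F] factor[OF that]
    by simp
  have composable: "src F x = rng F y"
    if "a g = Some x" "b h = Some y" "src G g = rng G h" for g h x y
    using that a'(5,6) b'(5,6) by (intro bundle_composable[OF bun]) auto
  have P_D: "P \<subseteq> D"
    by (auto simp: P_def)
  have "continuous_map (subtopology (gtop G) P) (subtopology (gtop G) (dom a)) l"
    by (rule continuous_map_from_subtopology_mono[OF l_cont P_D])
  from continuous_map_compose[OF this a'(3)]
  have la: "continuous_map (subtopology (gtop G) P) (gtop F) (\<lambda>k. the (a (l k)))"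
    by (simp add: o_def)
  have "continuous_map (subtopology (gtop G) P) (gtop G) r"
    by (rule continuous_map_from_subtopology_mono[OF r_cont P_D])
  then have "continuous_map (subtopology (gtop G) P) (subtopology (gtop G) (dom b)) r"
    using factor by (auto simp: continuous_map_in_subtopology)
  from continuous_map_compose[OF this b'(3)]
  have rb: "continuous_map (subtopology (gtop G) P) (gtop F) (\<lambda>k. the (b (r k)))"
    by (simp add: o_def)
  have "(the (a (l k)), the (b (r k))) \<in> composable F" if "k \<in> P" for k
    using factor[OF that] a'(5) b'(5) composable by (auto simp: composable_def)
  then have pair: "continuous_map (subtopology (gtop G) P)
      (subtopology (prod_topology (gtop F) (gtop F)) (composable F))
      (\<lambda>k. (the (a (l k)), the (b (r k))))"
    using la rb by (intro continuous_map_pair_into_subtopology) simp_all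
  have "continuous_map (subtopology (prod_topology (gtop F) (gtop F)) (composable F)) (gtop F)
      (\<lambda>(x, y). x \<cdot>\<^bsub>F\<^esub> y)"
    using bun by (simp add: groupoid_bundle_def topological_groupoid_def)
  from continuous_map_compose[OF pair this]
  have "continuous_map (subtopology (gtop G) P) (gtop F) (\<lambda>k. the (a (l k)) \<cdot>\<^bsub>F\<^esub> the (b (r k)))"
    by (simp add: o_def)
  then have cont: "continuous_map (subtopology (gtop G) P) (gtop F)
      (\<lambda>k. the (section_mul F G a b k))"
    by (rule continuous_map_eq) (simp add: prod_eq)
  have sec: "\<pi> z = k" if z: "section_mul F G a b k = Some z" for k z
  proof -
    obtain g h x y where gh: "a g = Some x" "b h = Some y" "src G g = rng G h"
        "k = g \<cdot>\<^bsub>G\<^esub> h" "z = x \<cdot>\<^bsub>F\<^esub> y"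
      using z unfolding Some_iff by blast
    then have "\<pi> z = \<pi> x \<cdot>\<^bsub>G\<^esub> \<pi> y"
      using bun composable[OF gh(1-3)] a'(5) b'(5)
      by (simp add: groupoid_bundle_def groupoid_functor_def)
    then show ?thesis
      using gh a'(6) b'(6) by simp
  qed
  have "slice G P"
    using G.slice_product[OF a'(2) b'(2)] dom_eq dom_P by simp
  then show ?thesis
    using P_open cont sec by (intro slice_sectionI) (simp_all add: dom_P)
qed

lemma section_mul_assoc:
  assumes bun: "groupoid_bundle F G \<pi>"
    and a: "a \<in> slice_sections F G \<pi>" and b: "b \<in> slice_sections F G \<pi>"
    and c: "c \<in> slice_sections F G \<pi>"
  shows "section_mul F G (section_mul F G a b) c = section_mul F G a (section_mul F G b c)"
proof -
  interpret G: groupoid G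
    using bun by (simp add: groupoid_bundle_def etale_groupoid_def topological_groupoid_def)
  interpret F: groupoid F
    using bun by (simp add: groupoid_bundle_def topological_groupoid_def)
  note a' = slice_sectionD[OF bun a] and b' = slice_sectionD[OF bun b]
    and c' = slice_sectionD[OF bun c]
  note ab = slice_sectionD[OF bun section_mul_closed[OF bun a b]]
    and bc = slice_sectionD[OF bun section_mul_closed[OF bun b c]]
  note iff = section_mul_Some_iff[OF G.groupoid_axioms]
  have assoc: "g \<cdot>\<^bsub>G\<^esub> h \<cdot>\<^bsub>G\<^esub> l = g \<cdot>\<^bsub>G\<^esub> (h \<cdot>\<^bsub>G\<^esub> l)" "x \<cdot>\<^bsub>F\<^esub> y \<cdot>\<^bsub>F\<^esub> w = x \<cdot>\<^bsub>F\<^esub> (y \<cdot>\<^bsub>F\<^esub> w)"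
      "src G (g \<cdot>\<^bsub>G\<^esub> h) = rng G l" "src G g = rng G (h \<cdot>\<^bsub>G\<^esub> l)"
    if "a g = Some x" "b h = Some y" "c l = Some w" "src G g = rng G h" "src G h = rng G l"
    for g h l x y w
  proof -
    have arrs: "g \<in> arr G" "h \<in> arr G" "l \<in> arr G" "x \<in> arr F" "y \<in> arr F" "w \<in> arr F"
      using that a'(4,5) b'(4,5) c'(4,5) by auto
    have "src F x = rng F y" "src F y = rng F w"
      using that arrs a'(6) b'(6) c'(6) by (auto intro!: bundle_composable[OF bun])
    then show "g \<cdot>\<^bsub>G\<^esub> h \<cdot>\<^bsub>G\<^esub> l = g \<cdot>\<^bsub>G\<^esub> (h \<cdot>\<^bsub>G\<^esub> l)" "x \<cdot>\<^bsub>F\<^esub> y \<cdot>\<^bsub>F\<^esub> w = x \<cdot>\<^bsub>F\<^esub> (y \<cdot>\<^bsub>F\<^esub> w)"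
      "src G (g \<cdot>\<^bsub>G\<^esub> h) = rng G l" "src G g = rng G (h \<cdot>\<^bsub>G\<^esub> l)"
      using arrs that by (simp_all add: G.mul_assoc F.mul_assoc G.src_mul G.rng_mul)
  qed
  have "section_mul F G (section_mul F G a b) c k = Some z \<longleftrightarrow>
        section_mul F G a (section_mul F G b c) k = Some z" (is "?L \<longleftrightarrow> ?R") for k z
  proof
    assume ?L
    then obtain m l u w where 1: "section_mul F G a b m = Some u" "c l = Some w"
        "src G m = rng G l" "k = m \<cdot>\<^bsub>G\<^esub> l" "z = u \<cdot>\<^bsub>F\<^esub> w"
      unfolding iff[OF ab(2) c'(2)] by blast
    then obtain g h x y where 2: "a g = Some x" "b h = Some y" "src G g = rng G h"
        "m = g \<cdot>\<^bsub>G\<^esub> h" "u = x \<cdot>\<^bsub>F\<^esub> y"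
      unfolding iff[OF a'(2) b'(2)] by blast
    have hl: "src G h = rng G l"
      using 1 2 a'(4) b'(4) by (simp add: G.src_mul)
    have "section_mul F G b c (h \<cdot>\<^bsub>G\<^esub> l) = Some (y \<cdot>\<^bsub>F\<^esub> w)"
      unfolding iff[OF b'(2) c'(2)] using 1 2 hl by blast
    then show ?R
      unfolding iff[OF a'(2) bc(2)] using assoc[OF 2(1,2) 1(2) 2(3) hl] 1 2 by metis
  next
    assume ?R
    then obtain g m x u where 1: "a g = Some x" "section_mul F G b c m = Some u"
        "src G g = rng G m" "k = g \<cdot>\<^bsub>G\<^esub> m" "z = x \<cdot>\<^bsub>F\<^esub> u"
      unfolding iff[OF a'(2) bc(2)] by blast
    then obtain h l y w where 2: "b h = Some y" "c l = Some w" "src G h = rng G l"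
        "m = h \<cdot>\<^bsub>G\<^esub> l" "u = y \<cdot>\<^bsub>F\<^esub> w"
      unfolding iff[OF b'(2) c'(2)] by blast
    have gh: "src G g = rng G h"
      using 1 2 b'(4) c'(4) by (simp add: G.rng_mul)
    have "section_mul F G a b (g \<cdot>\<^bsub>G\<^esub> h) = Some (x \<cdot>\<^bsub>F\<^esub> y)"
      unfolding iff[OF a'(2) b'(2)] using 1 2 gh by blast
    then show ?L
      unfolding iff[OF ab(2) c'(2)] using assoc[OF 1(1) 2(1,2) gh 2(3)] 1 2 by metis
  qed
  then show ?thesis
    by (intro ext) (metis option.exhaust)
qed

lemma semigroup_slice_sections:
  assumes "groupoid_bundle F G \<pi>"
  shows "semigroup_on (slice_sections F G \<pi>) (section_mul F G)"
  using section_mul_closed[OF assms] section_mul_assoc[OF assms] by (simp add: semigroup_on_def)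


section \<open>Zakrzewski morphisms and slices\<close>

lemma functorialD:
  assumes "functorial G H \<phi>" "(g, h) \<in> \<phi>"
  shows "g \<in> arr G" "h \<in> arr H" "(ginv G g, ginv H h) \<in> \<phi>"
    "(g', h') \<in> \<phi> \<Longrightarrow> src H h = rng H h' \<Longrightarrow> src G g = rng G g'"
    "(g', h') \<in> \<phi> \<Longrightarrow> src H h = rng H h' \<Longrightarrow> (g \<cdot>\<^bsub>G\<^esub> g', h \<cdot>\<^bsub>H\<^esub> h') \<in> \<phi>"
  using assms unfolding functorial_def by blast+

text \<open>If \<open>h\<close> and \<open>h'\<close> have the same range, then \<open>h\<^sup>-\<^sup>1h'\<close> is defined, and functoriality makes
  \<open>g\<^sup>-\<^sup>1g'\<close> defined as well.\<close>

lemma functorial_rng: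
  assumes "groupoid G" "groupoid H" and fn: "functorial G H \<phi>"
    and h: "(g, h) \<in> \<phi>" and h': "(g', h') \<in> \<phi>" and eq: "rng H h = rng H h'"
  shows "rng G g = rng G g'"
proof -
  interpret G: groupoid G by fact
  interpret H: groupoid H by fact
  have "src H (ginv H h) = rng H h'"
    using functorialD(2)[OF fn h] eq by (simp add: H.src_ginv)
  then have "src G (ginv G g) = rng G g'"
    by (rule functorialD(4)[OF fn functorialD(3)[OF fn h] h'])
  then show ?thesis
    using functorialD(1)[OF fn h] by (simp add: G.src_ginv)
qed

lemma functorial_slice_unique:
  assumes "groupoid G" "groupoid H" "functorial G H \<phi>" "slice G U"
    and "(g, h) \<in> \<phi>" "(g', h) \<in> \<phi>" "g \<in> U" "g' \<in> U"
  shows "g = g'"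
  using functorial_rng[OF assms(1-3,5,6)] slice_rng_eq[OF assms(4,7,8)] by blast

lemma functorial_rng_related:
  assumes "groupoid H" and fn: "functorial G H \<phi>" and h: "(g, h) \<in> \<phi>"
  shows "(rng G g, rng H h) \<in> \<phi>"
proof -
  interpret H: groupoid H by fact
  have "src H h = rng H (ginv H h)"
    using functorialD(2)[OF fn h] by (simp add: H.rng_ginv)
  then show ?thesis
    using functorialD(5)[OF fn h functorialD(3)[OF fn h]] by (simp add: rng_def)
qed

text \<open>Two arrows of \<open>\<phi> `` U\<close> with a common range are related to the same arrow of \<open>U\<close>, and then the uniqueness in
  star-bijectivity identifies them. Common sources reduce to common ranges by inversion.\<close>

lemma star_bijective_slice_image:
  assumes G: "groupoid G" and H: "groupoid H" and fn: "functorial G H \<phi>"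
    and star: "star_bijective G H \<phi>" and U: "slice G U"
  shows "slice H (\<phi> `` U)"
proof -
  interpret G: groupoid G by fact
  interpret H: groupoid H by fact
  have \<phi>_arr: "g \<in> arr G" "h \<in> arr H" if "(g, h) \<in> \<phi>" for g h
    using that fn by (auto simp: functorial_def)
  have star_unique: "h = h'" if "(g, h) \<in> \<phi>" "(g, h') \<in> \<phi>" "rng H h = rng H h'" for g h h'
  proof -
    have "\<exists>!i. i \<in> arr H \<and> rng H i = rng H h \<and> (g, i) \<in> \<phi>"
      using star that(1) \<phi>_arr functorial_rng_related[OF H fn that(1)] H.rng_in_units
      unfolding star_bijective_def by blast
    then show ?thesis
      using that \<phi>_arr by (metis (no_types))
  qed
  have "h = h'"
    if hh: "(g, h) \<in> \<phi>" "g \<in> U" "(g', h') \<in> \<phi>" "g' \<in> U" and e: "rng H h = rng H h'" for g h g' h'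
  proof -
    have "g = g'"
      using functorial_rng[OF G H fn hh(1,3) e] slice_rng_eq[OF U hh(2,4)] by blast
    then show ?thesis
      using star_unique hh e by blast
  qed
  moreover have "h = h'"
    if hh: "(g, h) \<in> \<phi>" "g \<in> U" "(g', h') \<in> \<phi>" "g' \<in> U" and e: "src H h = src H h'" for g h g' h'
  proof -
    have inv: "(ginv G g, ginv H h) \<in> \<phi>" "(ginv G g', ginv H h') \<in> \<phi>"
      using fn hh by (auto simp: functorial_def)
    have e': "rng H (ginv H h) = rng H (ginv H h')"
      using e hh \<phi>_arr by (metis H.rng_ginv)
    have "src G g = src G g'"
      using functorial_rng[OF G H fn inv e'] hh \<phi>_arr by (metis G.rng_ginv)
    then have "g = g'"
      by (rule slice_src_eq[OF U hh(2,4)])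
    then have "ginv H h = ginv H h'"
      using star_unique inv e' by blast
    then show ?thesis
      using hh \<phi>_arr by (metis H.ginv_ginv)
  qed
  ultimately show ?thesis
    unfolding slice_def inj_on_def using \<phi>_arr by blast
qed

text \<open>The existence half of star-bijectivity, in the form that makes the induced map multiplicative:
  factorisations lift along \<open>\<phi>\<close>.\<close>

lemma star_bijective_factor:
  assumes G: "groupoid G" and H: "groupoid H" and fn: "functorial G H \<phi>"
    and star: "star_bijective G H \<phi>"
    and g: "g \<in> arr G" and g': "g' \<in> arr G" and comp: "src G g = rng G g'"
    and k: "(g \<cdot>\<^bsub>G\<^esub> g', k) \<in> \<phi>"
  obtains h h' where "(g, h) \<in> \<phi>" "(g', h') \<in> \<phi>" "src H h = rng H h'" "k = h \<cdot>\<^bsub>H\<^esub> h'"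
proof -
  interpret G: groupoid G by fact
  interpret H: groupoid H by fact
  have k_arr: "k \<in> arr H"
    using k fn by (auto simp: functorial_def)
  have "(rng G g, rng H k) \<in> \<phi>"
    using functorial_rng_related[OF H fn k] g g' comp by (simp add: G.rng_mul)
  then obtain h where h: "h \<in> arr H" "rng H h = rng H k" "(g, h) \<in> \<phi>"
    using star g H.rng_in_units[OF k_arr] unfolding star_bijective_def by blast
  have "src H (ginv H h) = rng H k"
    using h by (simp add: H.src_ginv)
  then have "(ginv G g \<cdot>\<^bsub>G\<^esub> (g \<cdot>\<^bsub>G\<^esub> g'), ginv H h \<cdot>\<^bsub>H\<^esub> k) \<in> \<phi>"
    by (rule functorialD(5)[OF fn functorialD(3)[OF fn h(3)] k])
  then have "(g', ginv H h \<cdot>\<^bsub>H\<^esub> k) \<in> \<phi>"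
    using g g' comp by (simp add: G.ginv_mul_cancel)
  then show thesis
    using that[OF h(3)] H.left_quotient[OF h(1) k_arr h(2)] by simp
qed


section \<open>Pushing slice-sections along a Zakrzewski-Pierce morphism\<close>

definition push_section ::
  "('g \<times> 'h) set \<Rightarrow> ('f \<times> 'h \<Rightarrow> 'e) \<Rightarrow> ('g \<rightharpoonup> 'f) \<Rightarrow> ('h \<rightharpoonup> 'e)" where
  "push_section \<phi> \<tau> a =
     (\<lambda>h. if h \<in> \<phi> `` dom a then Some (\<tau> (rel_value (map_rel a O \<phi>) h, h)) else None)"

lemma map_rel_iff [simp]: "(x, y) \<in> map_rel f \<longleftrightarrow> f y = Some x"
  by (simp add: map_rel_def Map.graph_def)

lemma function_on_Some_iff: "function_on f D y = Some x \<longleftrightarrow> y \<in> D \<and> x = f y"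
  by (auto simp: function_on_def restrict_map_def)

lemma dom_push_section: "dom (push_section \<phi> \<tau> a) = \<phi> `` dom a"
  by (simp add: push_section_def dom_def)

lemma functional_section_comp:
  assumes "groupoid G" "groupoid H" "functorial G H \<phi>" "slice G (dom a)"
  shows "functional (map_rel a O \<phi>)"
  unfolding functional_def
proof (rule single_valuedI)
  fix h x x' assume "(h, x) \<in> (map_rel a O \<phi>)\<inverse>" "(h, x') \<in> (map_rel a O \<phi>)\<inverse>"
  then obtain g g' where "a g = Some x" "a g' = Some x'" "(g, h) \<in> \<phi>" "(g', h) \<in> \<phi>"
    by auto
  moreover from this have "g = g'"
    using functorial_slice_unique[OF assms] by blast
  ultimately show "x = x'" by simp
qed

lemma rel_value_eq:
  assumes "functional R" "(x, y) \<in> R"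
  shows "rel_value R y = x"
  unfolding rel_value_def using assms by (auto simp: functional_def single_valued_def)

lemma push_section_Some_iff:
  assumes "functional (map_rel a O \<phi>)"
  shows "push_section \<phi> \<tau> a h = Some z \<longleftrightarrow>
    (\<exists>g x. a g = Some x \<and> (g, h) \<in> \<phi> \<and> z = \<tau> (x, h))"
proof -
  have "rel_value (map_rel a O \<phi>) h = x" if "a g = Some x" "(g, h) \<in> \<phi>" for g x
    using that by (intro rel_value_eq[OF assms]) auto
  then show ?thesis
    by (auto simp: push_section_def ImageI domI)
qed

lemma push_section_in_slice_sections:
  assumes bun: "groupoid_bundle F G \<pi>"
    and zp: "zakrzewski_pierce_morphism F G \<pi> F' G' \<pi>' \<phi> \<tau>"
    and a: "a \<in> slice_sections F G \<pi>"
  shows "push_section \<phi> \<tau> a \<in> slice_sections F' G' \<pi>'"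
proof -
  have G: "groupoid G" and G': "groupoid G'" "topspace (gtop G') = arr G'"
    and fn: "functorial G G' \<phi>" and star: "star_bijective G G' \<phi>"
    and \<phi>_open: "\<And>W. openin (gtop G) W \<Longrightarrow> openin (gtop G') (\<phi> `` W)"
    using zp by (auto simp: zakrzewski_pierce_morphism_def zakrzewski_morphism_def
        etale_groupoid_def topological_groupoid_def)
  let ?P = "pullback F \<pi> G' \<phi>"
  have \<tau>: "continuous_map (gtop ?P) (gtop F') \<tau>" "\<And>p. p \<in> arr ?P \<Longrightarrow> \<pi>' (\<tau> p) = snd p"
    using zp by (auto simp: zakrzewski_pierce_morphism_def)
  note a' = slice_sectionD[OF bun a]
  note Some_iff = push_section_Some_iff[OF functional_section_comp[OF G G'(1) fn a'(2)]]
  have in_pullback: "(x, h) \<in> pullback_arrows F \<pi> G' \<phi>" if "a g = Some x" "(g, h) \<in> \<phi>" for g x h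
    using that a'(5,6) fn by (auto simp: pullback_arrows_def functorial_def)
  define D where "D = \<phi> `` dom a"
  define p where "p = (\<lambda>h. THE g. g \<in> dom a \<and> (g, h) \<in> \<phi>)"
  have p_eq: "p h = g" if "(g, h) \<in> \<phi>" "g \<in> dom a" for g h
    unfolding p_def using that functorial_slice_unique[OF G G'(1) fn a'(2)] by blast
  have "continuous_map (subtopology (gtop G') D) (subtopology (gtop G) (dom a)) p"
    unfolding D_def by (intro continuous_map_unique_partner a'(1) \<phi>_open p_eq)
  from continuous_map_compose[OF this a'(3)]
  have ap: "continuous_map (subtopology (gtop G') D) (gtop F) (\<lambda>h. the (a (p h)))"
    by (simp add: o_def)
  have "(the (a (p h)), h) \<in> pullback_arrows F \<pi> G' \<phi>" if h: "h \<in> D" for h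
  proof -
    obtain g x where g: "a g = Some x" "(g, h) \<in> \<phi>"
      using h by (auto simp: D_def)
    then show ?thesis
      using p_eq[OF g(2)] in_pullback[OF g] by (simp add: domI)
  qed
  then have "continuous_map (subtopology (gtop G') D) (gtop ?P) (\<lambda>h. (the (a (p h)), h))"
    using continuous_map_pair_into_subtopology[OF ap, of "gtop G'" "\<lambda>h. h"]
    by (simp add: pullback_def continuous_map_from_subtopology)
  from continuous_map_compose[OF this \<tau>(1)]
  have "continuous_map (subtopology (gtop G') D) (gtop F') (\<lambda>h. \<tau> (the (a (p h)), h))"
    by (simp add: o_def)
  moreover have "\<tau> (the (a (p h)), h) = the (push_section \<phi> \<tau> a h)" if h: "h \<in> D" for h
  proof -
    obtain g x where g: "a g = Some x" "(g, h) \<in> \<phi>"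
      using h by (auto simp: D_def)
    then have "push_section \<phi> \<tau> a h = Some (\<tau> (x, h))"
      unfolding Some_iff by blast
    then show ?thesis
      using g p_eq[OF g(2)] by (simp add: domI)
  qed
  ultimately have "continuous_map (subtopology (gtop G') D) (gtop F')
      (\<lambda>h. the (push_section \<phi> \<tau> a h))"
    by (rule continuous_map_eq) simp
  moreover have "\<pi>' z = h" if z: "push_section \<phi> \<tau> a h = Some z" for h z
  proof -
    obtain g x where "a g = Some x" "(g, h) \<in> \<phi>" "z = \<tau> (x, h)"
      using z unfolding Some_iff by blast
    then show ?thesis
      using \<tau>(2)[of "(x, h)"] in_pullback by (simp add: pullback_def)
  qed
  moreover have "slice G' D" "openin (gtop G') D"
    using star_bijective_slice_image[OF G G'(1) fn star a'(2)] \<phi>_open[OF a'(1)]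
    by (simp_all add: D_def)
  ultimately show ?thesis
    by (intro slice_sectionI) (simp_all add: dom_push_section D_def)
qed

text \<open>Both sides are described by pairs of arrows \<open>g\<close>, \<open>h\<close> from the two domains: on the left a \<open>k\<close> is
  related to \<open>gh\<close>, on the right \<open>k\<close> is a product of arrows related to \<open>g\<close> and to \<open>h\<close>. Functoriality of \<open>\<phi>\<close> and
  lifting of factorisations make these conditions equivalent, and \<open>\<tau>\<close> respects products.\<close>

lemma push_section_mul:
  assumes bun: "groupoid_bundle F G \<pi>"
    and zp: "zakrzewski_pierce_morphism F G \<pi> F' G' \<pi>' \<phi> \<tau>"
    and a: "a \<in> slice_sections F G \<pi>" and b: "b \<in> slice_sections F G \<pi>"
  shows "push_section \<phi> \<tau> (section_mul F G a b) =
         section_mul F' G' (push_section \<phi> \<tau> a) (push_section \<phi> \<tau> b)"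
proof -
  have zm: "zakrzewski_morphism G G' \<phi>"
    and G: "groupoid G" and G': "groupoid G'"
    and fn: "functorial G G' \<phi>" and star: "star_bijective G G' \<phi>"
    using zp by (auto simp: zakrzewski_pierce_morphism_def zakrzewski_morphism_def
        etale_groupoid_def topological_groupoid_def)
  let ?P = "pullback F \<pi> G' \<phi>"
  note a' = slice_sectionD[OF bun a] and b' = slice_sectionD[OF bun b]
    and ab = slice_sectionD[OF bun section_mul_closed[OF bun a b]]
  note push_iff = push_section_Some_iff[OF functional_section_comp[OF G G' fn]]
  have slices: "slice G' (dom (push_section \<phi> \<tau> a))" "slice G' (dom (push_section \<phi> \<tau> b))"
    unfolding dom_push_section using star_bijective_slice_image[OF G G' fn star] a'(2) b'(2) by auto
  note push_mul_iff = section_mul_Some_iff[OF G' slices]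
    and mul_iff = section_mul_Some_iff[OF G a'(2) b'(2)]
  have \<tau>_mul: "\<tau> (x \<cdot>\<^bsub>F\<^esub> y, h \<cdot>\<^bsub>G'\<^esub> h') = \<tau> (x, h) \<cdot>\<^bsub>F'\<^esub> \<tau> (y, h')"
    if xy: "a g = Some x" "b g' = Some y" "(g, h) \<in> \<phi>" "(g', h') \<in> \<phi>" "src G' h = rng G' h'"
    for g g' x y h h'
  proof -
    have P: "(x, h) \<in> arr ?P" "(y, h') \<in> arr ?P"
      using xy a'(5,6) b'(5,6) fn by (auto simp: pullback_def pullback_arrows_def functorial_def)
    have "src ?P (x, h) = rng ?P (y, h')"
      using pullback_composable[OF bun zm P] xy by simp
    then have "\<tau> ((x, h) \<cdot>\<^bsub>?P\<^esub> (y, h')) = \<tau> (x, h) \<cdot>\<^bsub>F'\<^esub> \<tau> (y, h')"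
      using zp P by (simp add: zakrzewski_pierce_morphism_def groupoid_functor_def)
    then show ?thesis
      by (simp add: pullback_def)
  qed
  have "push_section \<phi> \<tau> (section_mul F G a b) k = Some z \<longleftrightarrow>
        section_mul F' G' (push_section \<phi> \<tau> a) (push_section \<phi> \<tau> b) k = Some z"
    (is "?L \<longleftrightarrow> ?R") for k z
  proof
    assume ?L
    then obtain m u where m: "section_mul F G a b m = Some u" "(m, k) \<in> \<phi>" "z = \<tau> (u, k)"
      unfolding push_iff[OF ab(2)] by blast
    then obtain g g' x y where g: "a g = Some x" "b g' = Some y" "src G g = rng G g'"
        "m = g \<cdot>\<^bsub>G\<^esub> g'" "u = x \<cdot>\<^bsub>F\<^esub> y"
      unfolding mul_iff by blast
    have "(g \<cdot>\<^bsub>G\<^esub> g', k) \<in> \<phi>"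
      using m g by simp
    from star_bijective_factor[OF G G' fn star a'(4)[OF g(1)] b'(4)[OF g(2)] g(3) this]
    obtain h h' where h: "(g, h) \<in> \<phi>" "(g', h') \<in> \<phi>" "src G' h = rng G' h'" "k = h \<cdot>\<^bsub>G'\<^esub> h'" .
    have "push_section \<phi> \<tau> a h = Some (\<tau> (x, h))" "push_section \<phi> \<tau> b h' = Some (\<tau> (y, h'))"
      unfolding push_iff[OF a'(2)] push_iff[OF b'(2)] using g h by blast+
    moreover have "z = \<tau> (x, h) \<cdot>\<^bsub>F'\<^esub> \<tau> (y, h')"
      using \<tau>_mul[OF g(1,2) h(1-3)] m g h by simp
    ultimately show ?R
      unfolding push_mul_iff using h by blast
  next
    assume ?R
    then obtain h h' v w where h: "push_section \<phi> \<tau> a h = Some v" "push_section \<phi> \<tau> b h' = Some w"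
        "src G' h = rng G' h'" "k = h \<cdot>\<^bsub>G'\<^esub> h'" "z = v \<cdot>\<^bsub>F'\<^esub> w"
      unfolding push_mul_iff by blast
    then obtain g x g' y where g: "a g = Some x" "(g, h) \<in> \<phi>" "v = \<tau> (x, h)"
        "b g' = Some y" "(g', h') \<in> \<phi>" "w = \<tau> (y, h')"
      using h(1,2) unfolding push_iff[OF a'(2)] push_iff[OF b'(2)] by blast
    have comp: "src G g = rng G g'" "(g \<cdot>\<^bsub>G\<^esub> g', k) \<in> \<phi>"
      using functorialD(4,5)[OF fn g(2,5) h(3)] h(4) by simp_all
    have "section_mul F G a b (g \<cdot>\<^bsub>G\<^esub> g') = Some (x \<cdot>\<^bsub>F\<^esub> y)"
      unfolding mul_iff using g comp by blast
    moreover have "z = \<tau> (x \<cdot>\<^bsub>F\<^esub> y, k)"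
      using \<tau>_mul[OF g(1,4,2,5) h(3)] g h by simp
    ultimately show ?L
      unfolding push_iff[OF ab(2)] using comp by blast
  qed
  then show ?thesis
    by (intro ext) (metis option.exhaust)
qed

text \<open>The composite \<open>\<tau> \<circ> (((a \<circ> \<phi>) \<times> id) \<circ> \<delta>)\<close> has the full domain \<open>\<phi> `` dom a\<close> because every pair
  \<open>(a(g), h)\<close> with \<open>(g, h) \<in> \<phi>\<close> lies in the pullback, as \<open>\<pi>(a(g)) = g\<close>.\<close>

lemma map_rel_push_section:
  assumes bun: "groupoid_bundle F G \<pi>" and func: "functional (map_rel a O \<phi>)"
    and \<phi>: "\<phi> \<subseteq> arr G \<times> arr H" and a: "a \<in> slice_sections F G \<pi>"
  shows "map_rel (push_section \<phi> \<tau> a) =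
         map_rel (function_on \<tau> (arr (pullback F \<pi> H \<phi>))) O
           (rel_times (map_rel a O \<phi>) (map_rel (function_on (\<lambda>h. h) (arr H))) O
            map_rel (function_on (\<lambda>h. (h, h)) (arr H)))"
    (is "?L = ?R")
proof -
  have R_iff: "(z, h) \<in> ?R \<longleftrightarrow> (\<exists>g x. a g = Some x \<and> (g, h) \<in> \<phi> \<and> z = \<tau> (x, h))" for z h
  proof
    assume "(z, h) \<in> ?R"
    then show "\<exists>g x. a g = Some x \<and> (g, h) \<in> \<phi> \<and> z = \<tau> (x, h)"
      unfolding relcomp_unfold rel_times_def by (auto simp: function_on_Some_iff)
  next
    assume "\<exists>g x. a g = Some x \<and> (g, h) \<in> \<phi> \<and> z = \<tau> (x, h)"
    then obtain g x where g: "a g = Some x" "(g, h) \<in> \<phi>" "z = \<tau> (x, h)" by blast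
    then have h: "h \<in> arr H" and P: "(x, h) \<in> arr (pullback F \<pi> H \<phi>)"
      using \<phi> slice_sectionD(5,6)[OF bun a] by (auto simp: pullback_def pullback_arrows_def)
    have "(z, (x, h)) \<in> map_rel (function_on \<tau> (arr (pullback F \<pi> H \<phi>)))"
      using P g by (simp add: function_on_Some_iff)
    moreover have "((x, h), (h, h)) \<in>
        rel_times (map_rel a O \<phi>) (map_rel (function_on (\<lambda>h. h) (arr H)))"
      using g h by (auto simp: rel_times_def function_on_Some_iff)
    moreover have "((h, h), h) \<in> map_rel (function_on (\<lambda>h. (h, h)) (arr H))"
      using h by (simp add: function_on_Some_iff)
    ultimately show "(z, h) \<in> ?R" by (intro relcompI)
  qed
  have L_iff: "(z, h) \<in> ?L \<longleftrightarrow> (\<exists>g x. a g = Some x \<and> (g, h) \<in> \<phi> \<and> z = \<tau> (x, h))" for z h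
    unfolding map_rel_iff push_section_Some_iff[OF func] ..
  show ?thesis
    by (intro set_eqI) (simp only: split_paired_all L_iff R_iff)
qed


section \<open>The induced semigroup homomorphism\<close>

theorem theorem3p10:
  fixes F :: "'f top_groupoid_data" and G :: "'g top_groupoid_data" and \<pi> :: "'f \<Rightarrow> 'g"
    and F' :: "'f2 top_groupoid_data" and G' :: "'g2 top_groupoid_data" and \<pi>' :: "'f2 \<Rightarrow> 'g2"
    and \<phi> :: "('g \<times> 'g2) set" and \<tau> :: "'f \<times> 'g2 \<Rightarrow> 'f2"
  assumes "groupoid_bundle F G \<pi>"
    and "groupoid_bundle F' G' \<pi>'"
    and "zakrzewski_pierce_morphism F G \<pi> F' G' \<pi>' \<phi> \<tau>"
  shows "\<exists>\<Phi> :: ('g \<rightharpoonup> 'f) \<Rightarrow> ('g2 \<rightharpoonup> 'f2).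
    semigroup_hom (slice_sections F G \<pi>) (section_mul F G)
                  (slice_sections F' G' \<pi>') (section_mul F' G') \<Phi> \<and>
    (\<forall>a\<in>slice_sections F G \<pi>.
       map_rel (\<Phi> a) =
         map_rel (function_on \<tau> (arr (pullback F \<pi> G' \<phi>))) O
           (rel_times (map_rel a O \<phi>) (map_rel (function_on (\<lambda>g'. g') (arr G'))) O
            map_rel (function_on (\<lambda>g'. (g', g')) (arr G'))) \<and>
       dom (\<Phi> a) = \<phi> `` dom a \<and>
       functional (map_rel a O \<phi>) \<and>
       (\<forall>g'\<in>\<phi> `` dom a. \<Phi> a g' = Some (\<tau> (rel_value (map_rel a O \<phi>) g', g'))))"
proof (intro exI conjI ballI)
  let ?S = "slice_sections F G \<pi>" and ?S' = "slice_sections F' G' \<pi>'"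
  have G: "groupoid G" and G': "groupoid G'" and fn: "functorial G G' \<phi>"
    using assms(3) by (auto simp: zakrzewski_pierce_morphism_def zakrzewski_morphism_def
        etale_groupoid_def topological_groupoid_def)
  show "semigroup_hom ?S (section_mul F G) ?S' (section_mul F' G') (push_section \<phi> \<tau>)"
    using semigroup_slice_sections[OF assms(1)] semigroup_slice_sections[OF assms(2)]
      push_section_in_slice_sections[OF assms(1,3)] push_section_mul[OF assms(1,3)]
    by (simp add: semigroup_hom_def)
  fix a assume a: "a \<in> ?S"
  show func: "functional (map_rel a O \<phi>)"
    using functional_section_comp[OF G G' fn] slice_sectionD(2)[OF assms(1) a] by blast
  have "\<phi> \<subseteq> arr G \<times> arr G'"
    using fn by (simp add: functorial_def)
  then show "map_rel (push_section \<phi> \<tau> a) =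
         map_rel (function_on \<tau> (arr (pullback F \<pi> G' \<phi>))) O
           (rel_times (map_rel a O \<phi>) (map_rel (function_on (\<lambda>g'. g') (arr G'))) O
            map_rel (function_on (\<lambda>g'. (g', g')) (arr G')))"
    using map_rel_push_section[OF assms(1) func _ a] by blast
  show "dom (push_section \<phi> \<tau> a) = \<phi> `` dom a"
    by (rule dom_push_section)
  show "push_section \<phi> \<tau> a g' = Some (\<tau> (rel_value (map_rel a O \<phi>) g', g'))"
    if "g' \<in> \<phi> `` dom a" for g'
    using that by (simp add: push_section_def)
qed

end
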